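(* Let $F$ be a preordered topological vector space over $\mathbb{R}$ with positive wedge $F_+$, and let $E \subseteq F$ be a linear subspace. Suppose that the topological dual $F'$ separates points on $F$ and that $F_+$ is weakly closed (i.e. closed in the topology $\sigma(F,F')$). Then the set of all positive continuous linear functionals $E \to \mathbb{R}$ that can be extended to a positive continuous linear functional $F \to \mathbb{R}$ is weak-$*$ dense in $E_+'$ (i.e. dense in $E_+'$ with respect to the topology induced by $\sigma(E',E)$).
   Context: All vector spaces are over $\mathbb{R}$. A wedge in a vector space $V$ is a non-empty subset $\mathcal{K} \subseteq V$ that is closed under addition and under multiplication by non-negative scalars. A preordered topological vector space is a topological vector space $F$ together with a wedge $F_+ \subseteq F$ (the positive wedge). For a topological vector space $V$, $V'$ denotes its topological dual (the space of continuous linear functionals $V \to \mathbb{R}$). A linear subspace $E \subseteq F$ carries the subspace topology and the positive wedge $E_+ := F_+ \cap E$. A linear functional is positive if it takes non-negative values on the positive wedge, and $E_+'$ (respectively $F_+'$) denotes the dual wedge of all positive continuous linear functionals on $E$ (respectively on $F$). *)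

theory Defs
  imports "HOL-Analysis.Analysis"
begin

(* Not assumed Hausdorff. Continuity of negation, part of topological_ab_group_add, is redundant
   here: it follows from joint continuity of scalar multiplication. *)
class topological_real_vector = real_vector + topological_ab_group_add +
  assumes tendsto_scaleR_Pair:
    "LIM x (nhds a \<times>\<^sub>F nhds b). fst x *\<^sub>R snd x :> nhds (a *\<^sub>R b)"

instance real_normed_vector \<subseteq> topological_real_vector
proof
  fix a :: real and b :: 'a
  have "(fst \<longlongrightarrow> a) (nhds a \<times>\<^sub>F nhds b)" "(snd \<longlongrightarrow> b) (nhds a \<times>\<^sub>F nhds b)"
    by (rule filterlim_fst filterlim_snd)+
  then show "LIM x (nhds a \<times>\<^sub>F nhds b). fst x *\<^sub>R snd x :> nhds (a *\<^sub>R b)"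
    by (rule tendsto_scaleR)
qed

definition wedge :: "'a::real_vector set \<Rightarrow> bool" where
  "wedge K \<longleftrightarrow> K \<noteq> {} \<and> (\<forall>x\<in>K. \<forall>y\<in>K. x + y \<in> K) \<and> (\<forall>c\<ge>0. \<forall>x\<in>K. c *\<^sub>R x \<in> K)"

(* The dual of a subspace V with its subspace topology. A functional on V is a function on the
   whole type that takes the value undefined outside V, so that distinct elements of the dual
   are distinct on V. For V = UNIV extensionality is no restriction. *)
definition topological_dual :: "'a::topological_real_vector set \<Rightarrow> ('a \<Rightarrow> real) set" where
  "topological_dual V =
    {\<phi> \<in> extensional V.
      (\<forall>x\<in>V. \<forall>y\<in>V. \<phi> (x + y) = \<phi> x + \<phi> y) \<and>
      (\<forall>c. \<forall>x\<in>V. \<phi> (c *\<^sub>R x) = c * \<phi> x) \<and>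
      continuous_on V \<phi>}"

lemma topological_dual_UNIV:
  "\<phi> \<in> topological_dual UNIV \<longleftrightarrow> linear \<phi> \<and> continuous_on UNIV \<phi>"
  by (auto simp: topological_dual_def linear_iff)

definition dual_wedge :: "'a::topological_real_vector set \<Rightarrow> 'a set \<Rightarrow> ('a \<Rightarrow> real) set" where
  "dual_wedge V K = {\<phi> \<in> topological_dual V. \<forall>x\<in>K. 0 \<le> \<phi> x}"

(* The coarsest topology on X making all members of \<Phi> continuous; X itself is among the
   generators so that the underlying set is X even for empty \<Phi>. *)
definition initial_topology :: "'b set \<Rightarrow> ('b \<Rightarrow> real) set \<Rightarrow> 'b topology" where
  "initial_topology X \<Phi> =
    topology_generated_by (insert X {{x \<in> X. f x \<in> U} | f U. f \<in> \<Phi> \<and> open U})"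

definition weak_topology :: "'a::topological_real_vector set \<Rightarrow> 'a topology" where
  "weak_topology V = initial_topology V (topological_dual V)"

definition weak_star_topology :: "'a::topological_real_vector set \<Rightarrow> ('a \<Rightarrow> real) topology" where
  "weak_star_topology V = initial_topology (topological_dual V) ((\<lambda>x \<phi>. \<phi> x) ` V)"

end

theory Submission
  imports Defs
begin

text \<open>
  Basic neighbourhoods in both weak topologies only involve finitely many functionals or points, so
  Hahn--Banach is needed only in finite dimension, as the separation of a point from a convex cone
  at positive distance. Applied to the image of \<open>P\<close> under finitely many functionals, it shows that
  a point on which all positive functionals are nonnegative lies in \<open>P\<close>. Applied to the cone of
  values of the positive functionals at finitely many points of \<open>E\<close>, it shows that if a positive
  \<open>\<phi>\<close> on \<open>E\<close> cannot be approximated at these points, then some linear combination \<open>x\<close> of them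
  has \<open>\<phi> x < 0\<close> while all positive functionals are nonnegative at \<open>x\<close>; so \<open>x\<close> is in \<open>P\<close>, a
  contradiction.
\<close>

section \<open>Basic neighbourhoods in initial topologies\<close>

lemma topspace_initial_topology: "topspace (initial_topology X \<Phi>) = X"
  by (auto simp: initial_topology_def)

text \<open>Induction over the generation of open sets: an intersection takes the union of the two
  finite families and the smaller radius, and the generator \<open>X\<close> is covered by the empty
  family with an arbitrary radius.\<close>

lemma initial_topology_neighbourhood:
  assumes "openin (initial_topology X \<Phi>) U" "x \<in> U"
  obtains \<Psi> \<epsilon> where "finite \<Psi>" "\<Psi> \<subseteq> \<Phi>" "0 < \<epsilon>"
    "{y \<in> X. \<forall>f\<in>\<Psi>. \<bar>f y - f x\<bar> < \<epsilon>} \<subseteq> U"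
proof -
  let ?N = "\<lambda>\<Psi> \<epsilon>. {y \<in> X. \<forall>f\<in>\<Psi>. \<bar>f y - f x\<bar> < \<epsilon>}"
  have "generate_topology_on (insert X {{x \<in> X. f x \<in> U} | f U. f \<in> \<Phi> \<and> open U}) U"
    using assms(1) by (simp add: initial_topology_def openin_topology_generated_by_iff)
  then have "\<exists>\<Psi> \<epsilon>. finite \<Psi> \<and> \<Psi> \<subseteq> \<Phi> \<and> 0 < \<epsilon> \<and> ?N \<Psi> \<epsilon> \<subseteq> U"
    using assms(2)
  proof (induction rule: generate_topology_on.induct)
    case Empty
    then show ?case by simp
  next
    case (Int A B)
    then have "x \<in> A" "x \<in> B" by auto
    from Int.IH(1)[OF this(1)] obtain \<Psi> \<epsilon> where
      1: "finite \<Psi>" "\<Psi> \<subseteq> \<Phi>" "0 < \<epsilon>" "?N \<Psi> \<epsilon> \<subseteq> A" by blast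
    from Int.IH(2)[OF \<open>x \<in> B\<close>] obtain \<Psi>' \<epsilon>' where
      2: "finite \<Psi>'" "\<Psi>' \<subseteq> \<Phi>" "0 < \<epsilon>'" "?N \<Psi>' \<epsilon>' \<subseteq> B" by blast
    have "?N (\<Psi> \<union> \<Psi>') (min \<epsilon> \<epsilon>') \<subseteq> ?N \<Psi> \<epsilon> \<inter> ?N \<Psi>' \<epsilon>'" by auto
    with 1(4) 2(4) have "?N (\<Psi> \<union> \<Psi>') (min \<epsilon> \<epsilon>') \<subseteq> A \<inter> B" by blast
    moreover have "finite (\<Psi> \<union> \<Psi>')" "\<Psi> \<union> \<Psi>' \<subseteq> \<Phi>" "0 < min \<epsilon> \<epsilon>'" using 1 2 by auto
    ultimately show ?case by blast
  next
    case (UN \<K>)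
    then obtain K where "K \<in> \<K>" "x \<in> K" by auto
    with UN.IH[of K] obtain \<Psi> \<epsilon> where
      "finite \<Psi>" "\<Psi> \<subseteq> \<Phi>" "0 < \<epsilon>" "?N \<Psi> \<epsilon> \<subseteq> K" by auto
    with \<open>K \<in> \<K>\<close> show ?case by (meson Union_upper order_trans)
  next
    case (Basis S)
    then consider "S = X" | f V where "S = {x \<in> X. f x \<in> V}" "f \<in> \<Phi>" "open V" by auto
    then show ?case
    proof cases
      case 1
      then show ?thesis by (intro exI[of _ "{}"] exI[of _ 1]) auto
    next
      case 2
      with Basis have "f x \<in> V" by auto
      with 2 obtain \<epsilon> where "0 < \<epsilon>" "\<forall>y. dist y (f x) < \<epsilon> \<longrightarrow> y \<in> V"
        by (meson open_dist)
      with 2 show ?thesis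
        by (intro exI[of _ "{f}"] exI[of _ \<epsilon>]) (auto simp: dist_real_def)
    qed
  qed
  then show thesis using that by blast
qed

section \<open>Separation from a convex cone in finitely many coordinates\<close>

text \<open>Divide by \<open>t\<close> and let \<open>t\<close> tend to 0. This is the first-order
  condition at a minimum; restricting it to \<open>t \<le> 1\<close> lets it apply to the segment
  from a point of a cone to the apex.\<close>

lemma nonneg_if_quadratic_nonneg:
  fixes a b :: real
  assumes "\<And>t. 0 < t \<Longrightarrow> t \<le> 1 \<Longrightarrow> 0 \<le> 2 * t * a + t\<^sup>2 * b"
  shows "0 \<le> a"
proof (rule ccontr)
  assume "\<not> 0 \<le> a"
  \<comment> \<open>Chosen so that \<open>t * b \<le> - a\<close>, hence
    \<open>2 * a + t * b \<le> a < 0\<close>; the summand 1 keeps the denominator positive when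
    \<open>b\<close> is 0.\<close>
  define t where "t = min 1 (- a / (\<bar>b\<bar> + 1))"
  have t: "0 < t" "t \<le> 1" using \<open>\<not> 0 \<le> a\<close> by (auto simp: t_def divide_neg_pos)
  have "t * b \<le> t * (\<bar>b\<bar> + 1)" using t by (intro mult_left_mono) auto
  also have "\<dots> \<le> - a / (\<bar>b\<bar> + 1) * (\<bar>b\<bar> + 1)"
    by (intro mult_right_mono) (auto simp: t_def)
  also have "\<dots> = - a" by simp
  finally have "2 * a + t * b < 0" using \<open>\<not> 0 \<le> a\<close> by simp
  then have "t * (2 * a + t * b) < 0" using t by (simp add: mult_pos_neg)
  with assms[OF t] show False by (simp add: algebra_simps power2_eq_square)
qed

text \<open>
  The separating functional is \<open>w - v\<close>, where \<open>w\<close> is the point of the closure of \<open>C\<close> nearest to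
  \<open>v\<close>, obtained as the limit of a minimising sequence, which is Cauchy by the parallelogram law.
\<close>

lemma convex_cone_separation:
  fixes C :: "('i \<Rightarrow> real) set" and v :: "'i \<Rightarrow> real"
  assumes "finite I" "C \<noteq> {}"
    and add: "\<And>a b. a \<in> C \<Longrightarrow> b \<in> C \<Longrightarrow> \<exists>c\<in>C. \<forall>i\<in>I. c i = a i + b i"
    and scale: "\<And>t a. 0 \<le> t \<Longrightarrow> a \<in> C \<Longrightarrow> \<exists>c\<in>C. \<forall>i\<in>I. c i = t * a i"
    and "0 < \<epsilon>" and far: "\<And>c. c \<in> C \<Longrightarrow> \<exists>i\<in>I. \<epsilon> \<le> \<bar>c i - v i\<bar>"
  obtains l where "(\<Sum>i\<in>I. l i * v i) < 0" "\<And>c. c \<in> C \<Longrightarrow> 0 \<le> (\<Sum>i\<in>I. l i * c i)"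
proof -
  define q where "q = (\<lambda>c. \<Sum>i\<in>I. (c i - v i)\<^sup>2)"
  define d where "d = Inf (q ` C)"
  have q_ge: "\<epsilon>\<^sup>2 \<le> q c" if "c \<in> C" for c
  proof -
    from far[OF that] obtain i where i: "i \<in> I" "\<epsilon> \<le> \<bar>c i - v i\<bar>" by auto
    then have "\<epsilon>\<^sup>2 \<le> \<bar>c i - v i\<bar>\<^sup>2" using \<open>0 < \<epsilon>\<close> by (intro power_mono) auto
    also have "\<dots> \<le> q c"
      unfolding q_def using i(1) \<open>finite I\<close>
      by (simp, intro member_le_sum[where f = "\<lambda>i. (c i - v i)\<^sup>2"]) auto
    finally show ?thesis .
  qed
  have "\<epsilon>\<^sup>2 \<le> d" unfolding d_def using q_ge \<open>C \<noteq> {}\<close> by (intro cInf_greatest) auto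
  then have "0 < d" using \<open>0 < \<epsilon>\<close> by (smt (verit) zero_less_power)
  have bdd: "bdd_below (q ` C)" using q_ge by (rule bdd_belowI2)
  have d_le: "d \<le> q c" if "c \<in> C" for c
    unfolding d_def using bdd that by (auto intro: cInf_lower)
  \<comment> \<open>\<open>C\<close> is closed under conic combinations only up to agreement on
    \<open>I\<close>, but \<open>q\<close> sees no other coordinates, so the bound by
    \<open>d\<close> still holds for the combination itself.\<close>
  have d_le_cone: "d \<le> q (\<lambda>i. s * a i + t * b i)"
    if ab: "a \<in> C" "b \<in> C" and st: "0 \<le> s" "0 \<le> t" for a b s t
  proof -
    obtain a' b' where a'b': "a' \<in> C" "\<forall>i\<in>I. a' i = s * a i" "b' \<in> C" "\<forall>i\<in>I. b' i = t * b i"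
      using scale ab st by metis
    then obtain h where "h \<in> C" "\<forall>i\<in>I. h i = a' i + b' i" using add by metis
    moreover from this a'b' have "q h = q (\<lambda>i. s * a i + t * b i)"
      unfolding q_def by (intro sum.cong) auto
    ultimately show ?thesis using d_le by metis
  qed
  have "\<exists>c\<in>C. q c < d + 1 / real (Suc n)" for n
    using cInf_less_iff[of "q ` C" "d + 1 / real (Suc n)"] bdd \<open>C \<noteq> {}\<close> by (auto simp: d_def)
  then obtain c where c: "\<And>n. c n \<in> C" "\<And>n. q (c n) < d + 1 / real (Suc n)" by metis
  have Cauchy: "Cauchy (\<lambda>n. c n i)" if "i \<in> I" for i
  proof (rule metric_CauchyI)
    fix e :: real assume "0 < e"
    \<comment> \<open>With \<open>q (c m)\<close> and \<open>q (c n)\<close> below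
      \<open>d + e\<^sup>2 / 4\<close>, the parallelogram law bounds the squared distance by
      \<open>4 * (d + e\<^sup>2 / 4) - 4 * d = e\<^sup>2\<close>.\<close>
    then obtain N where N: "1 / real (Suc N) < e\<^sup>2 / 4"
      using reals_Archimedean[of "e\<^sup>2 / 4"] by (auto simp: inverse_eq_divide)
    have "dist (c m i) (c n i) < e" if mn: "N \<le> m" "N \<le> n" for m n
    proof -
      have small: "q (c k) < d + e\<^sup>2 / 4" if "N \<le> k" for k
      proof -
        have "1 / real (Suc k) \<le> 1 / real (Suc N)" using that by (simp add: frac_le)
        with c(2)[of k] N show ?thesis by linarith
      qed
      define h where "h = (\<lambda>i. 1/2 * c m i + 1/2 * c n i)"
      have "d \<le> q h" unfolding h_def by (intro d_le_cone c) auto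
      have "(c m i - c n i)\<^sup>2 \<le> (\<Sum>i\<in>I. (c m i - c n i)\<^sup>2)"
        using \<open>i \<in> I\<close> \<open>finite I\<close>
        by (intro member_le_sum[where f = "\<lambda>i. (c m i - c n i)\<^sup>2"]) auto
      \<comment> \<open>Parallelogram law for \<open>c m - v\<close> and \<open>c n - v\<close>; the
        midpoint \<open>h\<close> is a conic combination, so \<open>q h\<close> is at least
        \<open>d\<close>.\<close>
      also have "\<dots> = 2 * q (c m) + 2 * q (c n) - 4 * q h"
        unfolding q_def h_def sum_distrib_left sum.distrib[symmetric] sum_subtractf[symmetric]
        by (intro sum.cong refl) (simp add: power2_eq_square field_simps)
      also have "\<dots> < e\<^sup>2"
        using small[OF mn(1)] small[OF mn(2)] \<open>d \<le> q h\<close> by linarith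
      finally have "\<bar>c m i - c n i\<bar> < e"
        using \<open>0 < e\<close> by (metis power2_abs power_less_imp_less_base less_imp_le)
      then show ?thesis by (simp add: dist_real_def)
    qed
    then show "\<exists>N. \<forall>m\<ge>N. \<forall>n\<ge>N. dist (c m i) (c n i) < e" by blast
  qed
  define w where "w i = lim (\<lambda>n. c n i)" for i
  have w: "(\<lambda>n. c n i) \<longlonglongrightarrow> w i" if "i \<in> I" for i
    unfolding w_def using Cauchy[OF that]
    by (simp add: Cauchy_convergent convergent_LIMSEQ_iff[symmetric])
  have "(\<lambda>n. q (c n)) \<longlonglongrightarrow> q w" unfolding q_def by (intro tendsto_intros w)
  moreover have "(\<lambda>n. d + 1 / real (Suc n)) \<longlonglongrightarrow> d + 0"
    by (intro tendsto_add tendsto_const LIMSEQ_Suc[OF lim_1_over_n])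
  ultimately have "q w \<le> d + 0"
    by (rule LIMSEQ_le) (use c(2) less_imp_le in blast)
  then have "q w \<le> d" by simp
  define l where "l i = w i - v i" for i
  \<comment> \<open>Since \<open>q w \<le> d\<close>, a direction \<open>b\<close> along which
    \<open>q\<close> stays at least \<open>d\<close> cannot decrease \<open>q\<close> to first order
    at \<open>w\<close>; the derivative there is twice the sum.\<close>
  have first_variation: "0 \<le> (\<Sum>i\<in>I. l i * b i)"
    if "\<And>t. 0 < t \<Longrightarrow> t \<le> 1 \<Longrightarrow> d \<le> q (\<lambda>i. w i + t * b i)" for b
  proof (rule nonneg_if_quadratic_nonneg[where b = "\<Sum>i\<in>I. (b i)\<^sup>2"])
    fix t :: real assume t: "0 < t" "t \<le> 1"
    have "q (\<lambda>i. w i + t * b i) = q w + 2 * t * (\<Sum>i\<in>I. l i * b i) + t\<^sup>2 * (\<Sum>i\<in>I. (b i)\<^sup>2)"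
      unfolding q_def l_def sum_distrib_left sum.distrib[symmetric]
      by (intro sum.cong refl) (simp add: power2_eq_square algebra_simps)
    with that[OF t] \<open>q w \<le> d\<close>
    show "0 \<le> 2 * t * (\<Sum>i\<in>I. l i * b i) + t\<^sup>2 * (\<Sum>i\<in>I. (b i)\<^sup>2)" by linarith
  qed
  \<comment> \<open>\<open>w + t b\<close> is a limit of the conic combinations
    \<open>c n + t b\<close>, so \<open>d\<close> bounds \<open>q\<close> from below there
    too.\<close>
  have nonneg: "0 \<le> (\<Sum>i\<in>I. l i * b i)" if "b \<in> C" for b
  proof (rule first_variation)
    fix t :: real assume t: "0 < t" "t \<le> 1"
    have "(\<lambda>n. q (\<lambda>i. c n i + t * b i)) \<longlonglongrightarrow> q (\<lambda>i. w i + t * b i)"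
      unfolding q_def by (intro tendsto_intros w)
    moreover have "d \<le> q (\<lambda>i. c n i + t * b i)" for n
      using d_le_cone[OF c(1) that, where s = 1 and t = t] t by simp
    ultimately show "d \<le> q (\<lambda>i. w i + t * b i)" by (intro LIMSEQ_le_const) auto
  qed
  \<comment> \<open>The direction \<open>- w\<close> leads towards the apex:
    \<open>(1 - t) w\<close> is a limit of nonnegative multiples of the \<open>c n\<close> because
    \<open>t \<le> 1\<close>.\<close>
  have "0 \<le> (\<Sum>i\<in>I. l i * - w i)"
  proof (rule first_variation)
    fix t :: real assume t: "0 < t" "t \<le> 1"
    have "(\<lambda>n. q (\<lambda>i. (1 - t) * c n i)) \<longlonglongrightarrow> q (\<lambda>i. (1 - t) * w i)"
      unfolding q_def by (intro tendsto_intros w)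
    moreover have "d \<le> q (\<lambda>i. (1 - t) * c n i)" for n
      using d_le_cone[OF c(1) c(1), where s = "1 - t" and t = 0] t by simp
    ultimately have "d \<le> q (\<lambda>i. (1 - t) * w i)" by (intro LIMSEQ_le_const) auto
    then show "d \<le> q (\<lambda>i. w i + t * - w i)" by (simp add: algebra_simps)
  qed
  \<comment> \<open>From \<open>v = w - l\<close> on \<open>I\<close>, where the squares of
    \<open>l\<close> sum to \<open>q w\<close>; the value at \<open>v\<close> is therefore at most
    \<open>- d\<close>.\<close>
  moreover have "(\<Sum>i\<in>I. l i * v i) = - (\<Sum>i\<in>I. l i * - w i) - q w"
    unfolding q_def l_def sum_negf[symmetric] sum_subtractf[symmetric]
    by (intro sum.cong refl) (simp add: power2_eq_square algebra_simps)
  moreover have "d \<le> q w"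
    using \<open>(\<lambda>n. q (c n)) \<longlonglongrightarrow> q w\<close> d_le[OF c(1)] by (intro LIMSEQ_le_const) auto
  ultimately have "(\<Sum>i\<in>I. l i * v i) < 0" using \<open>0 < d\<close> by linarith
  then show thesis using that nonneg by blast
qed

section \<open>Recovering a weakly closed wedge from its positive functionals\<close>

lemma topological_dual_UNIV_sum:
  assumes "\<And>i. i \<in> I \<Longrightarrow> f i \<in> topological_dual UNIV"
  shows "(\<lambda>x. \<Sum>i\<in>I. l i * f i x) \<in> topological_dual UNIV"
proof -
  have "linear (\<lambda>x. l i * f i x)" if "i \<in> I" for i
    using assms[OF that] linear_compose_scale_right[of "f i" "l i"]
    by (simp add: topological_dual_UNIV)
  moreover have "continuous_on UNIV (\<lambda>x. \<Sum>i\<in>I. l i * f i x)"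
    using assms by (intro continuous_intros) (auto simp: topological_dual_UNIV)
  ultimately show ?thesis by (auto simp: topological_dual_UNIV intro: linear_compose_sum)
qed

text \<open>The bipolar theorem for \<open>P\<close>. If \<open>x\<close> is outside
  \<open>P\<close>, some basic weak neighbourhood of \<open>x\<close> misses \<open>P\<close>;
  separating in the coordinates given by its functionals yields a positive functional that is
  negative at \<open>x\<close>.\<close>

lemma mem_weakly_closed_wedge:
  fixes P :: "'a::topological_real_vector set"
  assumes "wedge P" "closedin (weak_topology UNIV) P"
    and pos: "\<And>\<psi>. \<psi> \<in> dual_wedge UNIV P \<Longrightarrow> 0 \<le> \<psi> x"
  shows "x \<in> P"
proof (rule ccontr)
  assume "x \<notin> P"
  have "openin (initial_topology UNIV (topological_dual UNIV)) (UNIV - P)"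
    using assms(2) by (simp add: closedin_def weak_topology_def topspace_initial_topology)
  then obtain \<Psi> \<epsilon> where \<Psi>: "finite \<Psi>" "\<Psi> \<subseteq> topological_dual (UNIV :: 'a set)" "0 < \<epsilon>"
    "{y \<in> UNIV. \<forall>f\<in>\<Psi>. \<bar>f y - f x\<bar> < \<epsilon>} \<subseteq> UNIV - P"
    by (rule initial_topology_neighbourhood[where x = x]) (use \<open>x \<notin> P\<close> in auto)
  have linear: "f (y + z) = f y + f z" "f (t *\<^sub>R y) = t * f y" if "f \<in> \<Psi>" for f y z t
    using that \<Psi>(2) by (auto simp: topological_dual_def)
  \<comment> \<open>The functionals in \<open>\<Psi>\<close> serve as the index set: each
    \<open>p\<close> becomes the vector of its values under them.\<close>
  obtain l where l: "(\<Sum>f\<in>\<Psi>. l f * f x) < 0"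
    "\<And>c. c \<in> (\<lambda>p f. f p) ` P \<Longrightarrow> 0 \<le> (\<Sum>f\<in>\<Psi>. l f * c f)"
  proof (rule convex_cone_separation[of \<Psi> "(\<lambda>p f. f p) ` P" \<epsilon> "\<lambda>f. f x"])
    show "\<exists>c\<in>(\<lambda>p f. f p) ` P. \<forall>f\<in>\<Psi>. c f = a f + b f"
      if "a \<in> (\<lambda>p f. f p) ` P" "b \<in> (\<lambda>p f. f p) ` P" for a b
    proof -
      from that obtain p r where "p \<in> P" "r \<in> P" "a = (\<lambda>f. f p)" "b = (\<lambda>f. f r)" by blast
      with \<open>wedge P\<close> show ?thesis
        by (intro bexI[of _ "\<lambda>f. f (p + r)"]) (auto simp: wedge_def linear)
    qed
    show "\<exists>c\<in>(\<lambda>p f. f p) ` P. \<forall>f\<in>\<Psi>. c f = t * a f"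
      if "0 \<le> t" "a \<in> (\<lambda>p f. f p) ` P" for t a
    proof -
      from that obtain p where "p \<in> P" "a = (\<lambda>f. f p)" by blast
      with \<open>wedge P\<close> \<open>0 \<le> t\<close> show ?thesis
        by (intro bexI[of _ "\<lambda>f. f (t *\<^sub>R p)"]) (auto simp: wedge_def linear)
    qed
    show "\<exists>f\<in>\<Psi>. \<epsilon> \<le> \<bar>c f - f x\<bar>" if "c \<in> (\<lambda>p f. f p) ` P" for c
      using that \<Psi>(4) by (force simp: not_less)
  qed (use \<Psi> \<open>wedge P\<close> in \<open>auto simp: wedge_def\<close>)
  have "(\<lambda>y. \<Sum>f\<in>\<Psi>. l f * f y) \<in> dual_wedge UNIV P"
    using l(2) \<Psi>(2) topological_dual_UNIV_sum[of \<Psi> "\<lambda>f. f" l] by (auto simp: dual_wedge_def)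
  from pos[OF this] l(1) show False by simp
qed

section \<open>Restriction to the subspace and density\<close>

lemma restrict_dual_wedge:
  assumes "subspace E" "\<psi> \<in> dual_wedge UNIV P"
  shows "restrict \<psi> E \<in> dual_wedge E (P \<inter> E)"
proof -
  have "continuous_on E (restrict \<psi> E)"
    using assms(2) continuous_on_subset[of UNIV \<psi> E]
    by (auto simp: dual_wedge_def topological_dual_def cong: continuous_on_cong_simp)
  then show ?thesis
    using assms by (auto simp: dual_wedge_def topological_dual_def subspace_add subspace_scale)
qed

lemma topological_dual_sum:
  assumes "subspace E" "\<phi> \<in> topological_dual E" "finite A" "A \<subseteq> E"
  shows "\<phi> (\<Sum>a\<in>A. l a *\<^sub>R a) = (\<Sum>a\<in>A. l a * \<phi> a)"
  using assms(3,4)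
proof (induction A)
  case empty
  have "\<phi> (0 *\<^sub>R 0) = 0 * \<phi> 0"
    using assms(1,2) subspace_0 unfolding topological_dual_def by blast
  then show ?case by simp
next
  case (insert a A)
  then have "(\<Sum>a\<in>A. l a *\<^sub>R a) \<in> E" "l a *\<^sub>R a \<in> E" "a \<in> E"
    using assms(1) by (auto intro!: subspace_sum subspace_scale)
  with insert assms(2) show ?case by (simp add: topological_dual_def)
qed

text \<open>The dual use of the separation: the points of \<open>A\<close> are now the indices and
  functionals the vectors, so the separating coefficients define a point of
  \<open>E\<close>.\<close>

lemma approximate_by_positive_extendable:
  fixes P E :: "'a::topological_real_vector set"
  assumes "wedge P" "subspace E" "closedin (weak_topology UNIV) P"
    and \<phi>: "\<phi> \<in> dual_wedge E (P \<inter> E)" and A: "finite A" "A \<subseteq> E" and "0 < \<epsilon>"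
  shows "\<exists>\<psi>\<in>dual_wedge UNIV P. \<forall>a\<in>A. \<bar>\<psi> a - \<phi> a\<bar> < \<epsilon>"
proof (rule ccontr)
  assume far: "\<not> ?thesis"
  have sum: "(\<lambda>x. \<psi> x + \<theta> x) \<in> dual_wedge UNIV P"
    if "\<psi> \<in> dual_wedge UNIV P" "\<theta> \<in> dual_wedge UNIV P" for \<psi> \<theta> :: "'a \<Rightarrow> real"
    using that by (auto simp: dual_wedge_def topological_dual_def algebra_simps
        intro!: continuous_intros)
  have scale: "(\<lambda>x. t * \<psi> x) \<in> dual_wedge UNIV P"
    if "0 \<le> t" "\<psi> \<in> dual_wedge UNIV P" for t and \<psi> :: "'a \<Rightarrow> real"
    using that by (auto simp: dual_wedge_def topological_dual_def algebra_simps
        intro!: continuous_intros)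
  have zero: "(\<lambda>x. 0) \<in> dual_wedge UNIV P"
    by (auto simp: dual_wedge_def topological_dual_def)
  obtain l where l: "(\<Sum>a\<in>A. l a * \<phi> a) < 0"
    "\<And>\<psi>. \<psi> \<in> dual_wedge UNIV P \<Longrightarrow> 0 \<le> (\<Sum>a\<in>A. l a * \<psi> a)"
  proof (rule convex_cone_separation[of A "dual_wedge UNIV P" \<epsilon> \<phi>])
    show "\<exists>\<omega>\<in>dual_wedge UNIV P. \<forall>a\<in>A. \<omega> a = \<psi> a + \<theta> a"
      if "\<psi> \<in> dual_wedge UNIV P" "\<theta> \<in> dual_wedge UNIV P" for \<psi> \<theta>
      using sum[OF that] by (rule bexI[rotated]) simp
    show "\<exists>\<omega>\<in>dual_wedge UNIV P. \<forall>a\<in>A. \<omega> a = t * \<psi> a"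
      if "0 \<le> t" "\<psi> \<in> dual_wedge UNIV P" for t \<psi>
      using scale[OF that] by (rule bexI[rotated]) simp
    show "\<exists>a\<in>A. \<epsilon> \<le> \<bar>\<psi> a - \<phi> a\<bar>" if "\<psi> \<in> dual_wedge UNIV P" for \<psi>
      using far that by (auto simp: not_less)
  qed (use A \<open>0 < \<epsilon>\<close> zero in auto)
  define x where "x = (\<Sum>a\<in>A. l a *\<^sub>R a)"
  have "x \<in> P"
    using assms(1,3)
  proof (rule mem_weakly_closed_wedge)
    fix \<psi> :: "'a \<Rightarrow> real" assume "\<psi> \<in> dual_wedge UNIV P"
    then show "0 \<le> \<psi> x"
      using l(2) topological_dual_sum[OF subspace_UNIV _ A(1)]
      by (simp add: x_def dual_wedge_def)
  qed
  moreover have "x \<in> E"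
    unfolding x_def using A assms(2) by (auto intro!: subspace_sum subspace_scale)
  \<comment> \<open>\<open>\<phi>\<close> is known to be nonnegative only on
    \<open>P \<inter> E\<close>, so both memberships enter.\<close>
  ultimately have "0 \<le> \<phi> x" using \<phi> by (simp add: dual_wedge_def)
  moreover have "\<phi> x = (\<Sum>a\<in>A. l a * \<phi> a)"
    using topological_dual_sum[OF assms(2) _ A] \<phi> by (simp add: x_def dual_wedge_def)
  ultimately show False using l(1) by simp
qed

theorem theorem1:
  fixes P E :: "'a::topological_real_vector set"
  assumes "wedge P"
    and "subspace E"
    and "\<forall>x y. x \<noteq> y \<longrightarrow> (\<exists>\<psi>\<in>topological_dual (UNIV :: 'a set). \<psi> x \<noteq> \<psi> y)"
    and "closedin (weak_topology UNIV) P"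
  shows "subtopology (weak_star_topology E) (dual_wedge E (P \<inter> E)) closure_of
      {\<phi> \<in> dual_wedge E (P \<inter> E). \<exists>\<psi>\<in>dual_wedge UNIV P. \<forall>x\<in>E. \<psi> x = \<phi> x}
    = dual_wedge E (P \<inter> E)"
    (is "?T closure_of ?S = ?D")
proof (rule antisym)
  have space: "topspace ?T = ?D"
    by (auto simp: weak_star_topology_def topspace_initial_topology dual_wedge_def)
  show "?T closure_of ?S \<subseteq> ?D" using closure_of_subset_topspace[of ?T ?S] space by simp
  show "?D \<subseteq> ?T closure_of ?S"
  proof
    fix \<phi> assume \<phi>: "\<phi> \<in> ?D"
    have "\<exists>\<theta>\<in>?S. \<theta> \<in> V" if V: "\<phi> \<in> V" "openin ?T V" for V
    proof -
      obtain U where U: "openin (weak_star_topology E) U" "V = U \<inter> ?D"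
        using V(2) by (auto simp: openin_subtopology)
      have "\<phi> \<in> U" using V(1) U(2) by simp
      with U(1) obtain \<Psi> \<epsilon> where \<Psi>: "finite \<Psi>" "\<Psi> \<subseteq> (\<lambda>x \<phi>. \<phi> x) ` E" "0 < \<epsilon>"
        "{\<theta> \<in> topological_dual E. \<forall>f\<in>\<Psi>. \<bar>f \<theta> - f \<phi>\<bar> < \<epsilon>} \<subseteq> U"
        unfolding weak_star_topology_def by (rule initial_topology_neighbourhood)
      then obtain A where A: "finite A" "A \<subseteq> E" "\<Psi> = (\<lambda>x \<phi>. \<phi> x) ` A"
        by (meson finite_subset_image)
      obtain \<psi> where \<psi>: "\<psi> \<in> dual_wedge UNIV P" "\<forall>a\<in>A. \<bar>\<psi> a - \<phi> a\<bar> < \<epsilon>"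
        using approximate_by_positive_extendable[OF assms(1,2,4) \<phi> A(1,2) \<Psi>(3)] by auto
      \<comment> \<open>Elements of the dual of \<open>E\<close> take the value
        \<open>undefined\<close> outside \<open>E\<close>, so the approximant is the restriction of
        \<open>\<psi>\<close>, with \<open>\<psi>\<close> itself as its positive extension.\<close>
      have D: "restrict \<psi> E \<in> ?D" using assms(2) \<psi>(1) by (rule restrict_dual_wedge)
      then have "restrict \<psi> E \<in> topological_dual E" by (simp add: dual_wedge_def)
      with \<psi>(2) A \<Psi>(4) have "restrict \<psi> E \<in> U" by (auto simp: subset_iff)
      moreover have "restrict \<psi> E \<in> ?S" using D \<psi>(1) by auto
      ultimately show ?thesis using D U(2) by blast
    qed
    then show "\<phi> \<in> ?T closure_of ?S" using \<phi> space by (auto simp: in_closure_of)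
  qed
qed

end
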